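(* Let $b\ge3$ be an integer, let $T_b:[0,1)\to[0,1)$, $x\mapsto bx\pmod 1$, and let $\{B_n\}_{n=0}^\infty$ be a sequence of open balls in $[0,1)$. Let $$K(\{B_n\})=\{x\in[0,1): T_b^n(x)\notin B_n\text{ for all but finitely many }n\}.$$ (i) If $\lim_{n\to\infty}\operatorname{diam}(B_n)=0$, then $\dim_H K(\{B_n\})=1$. (ii) If $\dim_H K(\{B_n\})=1$, then $\liminf_{n\to\infty}\operatorname{diam}(B_n)=0$.
   Context: $\dim_H$ denotes Hausdorff dimension and $\operatorname{diam}$ denotes diameter, with respect to the usual metric $|x-y|$ on $[0,1)$. *)

theory Defs
  imports "HOL-Analysis.Analysis"
begin

text \<open>
  The summand \<open>diam(U)\<^sup>s\<close>, with the usual conventions: the empty set contributes 0,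
  and \<open>0\<^sup>0 = 1\<close> for nonempty sets (whereas \<open>0 powr 0 = 0\<close>).
\<close>
definition diam_pow :: "real \<Rightarrow> 'a::metric_space set \<Rightarrow> ennreal" where
  "diam_pow s U = (if U = {} then 0 else if s = 0 then 1 else ennreal (diameter U powr s))"

text \<open>Boundedness is required explicitly because \<open>diameter\<close> is unspecified on unbounded sets.\<close>
definition delta_cover :: "real \<Rightarrow> 'a::metric_space set \<Rightarrow> (nat \<Rightarrow> 'a set) \<Rightarrow> bool" where
  "delta_cover \<delta> E U \<longleftrightarrow> E \<subseteq> (\<Union>i. U i) \<and> (\<forall>i. bounded (U i) \<and> diameter (U i) \<le> \<delta>)"

definition hausdorff_premeasure :: "real \<Rightarrow> real \<Rightarrow> 'a::metric_space set \<Rightarrow> ennreal" where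
  "hausdorff_premeasure s \<delta> E = (INF U\<in>{U. delta_cover \<delta> E U}. \<Sum>i. diam_pow s (U i))"

definition hausdorff_measure :: "real \<Rightarrow> 'a::metric_space set \<Rightarrow> ennreal" where
  "hausdorff_measure s E = (SUP \<delta>\<in>{0<..}. hausdorff_premeasure s \<delta> E)"

definition hausdorff_dim :: "'a::metric_space set \<Rightarrow> ennreal" where
  "hausdorff_dim E = (INF s\<in>{s. 0 \<le> s \<and> hausdorff_measure s E = 0}. ennreal s)"

definition T_map :: "int \<Rightarrow> real \<Rightarrow> real" where
  "T_map b x = frac (of_int b * x)"

text \<open>Open balls of the metric space \<open>[0,1)\<close>: centre in \<open>[0,1)\<close>, positive radius, and the
  metric \<open>\<bar>x - y\<bar>\<close> (not the metric of the circle).\<close>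
definition open_ball_01 :: "real set \<Rightarrow> bool" where
  "open_ball_01 B \<longleftrightarrow> (\<exists>c\<in>{0..<1}. \<exists>r>0. B = ball c r \<inter> {0..<1})"

definition K_set :: "int \<Rightarrow> (nat \<Rightarrow> real set) \<Rightarrow> real set" where
  "K_set b B = {x \<in> {0..<1}. finite {n. (T_map b ^^ n) x \<in> B n}}"

end

theory Submission
  imports Defs
begin

text \<open>
  Part (ii): if the diameters stay above \<open>\<epsilon>\<close>, then for a suitable \<open>m\<close> every late ball contains a full
  \<open>b\<close>-adic interval of length \<open>b\<^sup>-\<^sup>m\<close>. In base \<open>Q = b\<^sup>m\<close> every late digit therefore has a forbidden
  value, and covering by \<open>Q\<close>-adic intervals gives dimension at most \<open>log\<^sub>Q (Q - 1/2) < 1\<close>.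

  Part (i): pass to base \<open>Q = b\<^sup>l\<close> and charge the time \<open>n\<close> to the first base-\<open>Q\<close> digit \<open>j\<close> with
  \<open>n \<le> j l\<close>. If \<open>diam B\<^sub>n < b\<^sup>-\<^sup>2\<^sup>l\<close>, then \<open>T\<^sup>n x \<in> B\<^sub>n\<close> forces this digit into a set of at most two
  values, so \<open>K\<close> contains the points whose \<open>j\<close>-th digit avoids at most \<open>2 l\<close> values and \<open>Q - 1\<close>.
  With \<open>q = Q - 1 - 2 l\<close> admissible digits, rewriting base-\<open>q\<close> digits as admissible base-\<open>Q\<close> digits
  is a map \<open>h : [0,1) \<rightarrow> K\<close> under which preimages of sets of diameter \<open>d\<close> have Lebesgue
  measure at most \<open>2 q d\<^sup>s\<close> whenever \<open>Q\<^sup>s \<le> q\<close>; for each \<open>s < 1\<close> this holds once \<open>l\<close> is large.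
\<close>

section \<open>Null sets of Hausdorff measure\<close>

lemma hausdorff_measure_mono:
  assumes "E \<subseteq> F"
  shows "hausdorff_measure s E \<le> hausdorff_measure s F"
proof -
  have "hausdorff_premeasure s \<delta> E \<le> hausdorff_premeasure s \<delta> F" for \<delta>
    using assms unfolding hausdorff_premeasure_def delta_cover_def
    by (intro INF_superset_mono) (blast, simp)
  then show ?thesis
    unfolding hausdorff_measure_def by (intro SUP_mono) auto
qed

lemma hausdorff_measure_eq_0I:
  assumes "\<And>\<delta> \<epsilon>. 0 < \<delta> \<Longrightarrow> 0 < \<epsilon> \<Longrightarrow>
    \<exists>U. delta_cover \<delta> E U \<and> (\<Sum>i. diam_pow s (U i)) \<le> ennreal \<epsilon>"
  shows "hausdorff_measure s E = 0"
proof -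
  have "hausdorff_premeasure s \<delta> E \<le> 0" if \<delta>: "\<delta> > 0" for \<delta>
  proof (rule ennreal_le_epsilon)
    fix \<epsilon> :: real assume "\<epsilon> > 0"
    then obtain U where "delta_cover \<delta> E U" "(\<Sum>i. diam_pow s (U i)) \<le> ennreal \<epsilon>"
      using assms[OF \<delta> \<open>\<epsilon> > 0\<close>] by blast
    then show "hausdorff_premeasure s \<delta> E \<le> 0 + ennreal \<epsilon>"
      unfolding hausdorff_premeasure_def by (simp add: INF_lower2)
  qed
  then have "hausdorff_measure s E \<le> 0"
    unfolding hausdorff_measure_def by (intro SUP_least) simp
  then show ?thesis by simp
qed

lemma hausdorff_measure_eq_0D:
  assumes "hausdorff_measure s E = 0" "0 < \<delta>" "0 < \<epsilon>"
  obtains U where "delta_cover \<delta> E U" "(\<Sum>i. diam_pow s (U i)) < ennreal \<epsilon>"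
proof -
  have "hausdorff_premeasure s \<delta> E \<le> hausdorff_measure s E"
    unfolding hausdorff_measure_def by (rule SUP_upper) (use assms in auto)
  then have "hausdorff_premeasure s \<delta> E < ennreal \<epsilon>"
    using assms by simp
  then show ?thesis
    unfolding hausdorff_premeasure_def INF_less_iff using that by auto
qed

lemma hausdorff_measure_UN_null:
  fixes E :: "nat \<Rightarrow> 'a::metric_space set"
  assumes "\<And>n. hausdorff_measure s (E n) = 0"
  shows "hausdorff_measure s (\<Union>n. E n) = 0"
proof (rule hausdorff_measure_eq_0I)
  fix \<delta> \<epsilon> :: real assume pos: "0 < \<delta>" "0 < \<epsilon>"
  have "\<exists>U. delta_cover \<delta> (E n) U \<and> (\<Sum>i. diam_pow s (U i)) < ennreal (\<epsilon> * (1/2) ^ Suc n)" for n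
    using hausdorff_measure_eq_0D[OF assms pos(1), of "\<epsilon> * (1/2) ^ Suc n" n] pos
    by (metis mult_pos_pos zero_less_divide_1_iff zero_less_numeral zero_less_power)
  then obtain U where U: "\<And>n. delta_cover \<delta> (E n) (U n)"
    and sU: "\<And>n. (\<Sum>i. diam_pow s (U n i)) < ennreal (\<epsilon> * (1/2) ^ Suc n)"
    by metis
  \<comment> \<open>The double sequence of covers is flattened by the pairing bijection; the budgets
    \<open>\<epsilon> * (1/2) ^ Suc n\<close> add up to \<open>\<epsilon>\<close>.\<close>
  define V where "V i = case_prod U (prod_decode i)" for i
  have "x \<in> (\<Union>i. V i)" if "x \<in> E n" for x n
  proof -
    have "x \<in> (\<Union>i. U n i)" using U[of n] that unfolding delta_cover_def by (meson subsetD)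
    then obtain i where "x \<in> U n i" by blast
    then have "x \<in> V (prod_encode (n, i))" by (simp add: V_def)
    then show ?thesis by blast
  qed
  moreover have "bounded (V i) \<and> diameter (V i) \<le> \<delta>" for i
    using U by (auto simp: V_def delta_cover_def split: prod.split)
  ultimately have "delta_cover \<delta> (\<Union>n. E n) V"
    unfolding delta_cover_def by blast
  moreover have "(\<Sum>i. diam_pow s (V i)) \<le> ennreal \<epsilon>"
  proof -
    have "(\<Sum>i. diam_pow s (V i)) = (\<Sum>n. \<Sum>i. diam_pow s (U n i))"
      unfolding V_def
      using suminf_ennreal_2dimen[of "\<lambda>n. \<Sum>i. diam_pow s (U n i)" "\<lambda>p. diam_pow s (case_prod U p)"]
      by simp
    also have "\<dots> \<le> (\<Sum>n. ennreal (\<epsilon> * (1/2) ^ Suc n))"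
      by (intro suminf_le less_imp_le[OF sU]) auto
    also have "\<dots> = ennreal \<epsilon>"
      using sums_mult[OF power_half_series, of \<epsilon>] pos
      by (intro suminf_ennreal_eq) auto
    finally show ?thesis .
  qed
  ultimately show "\<exists>U. delta_cover \<delta> (\<Union>n. E n) U \<and> (\<Sum>i. diam_pow s (U i)) \<le> ennreal \<epsilon>"
    by blast
qed

text \<open>A Q-adic cell of level k has diameter at most Q^-k, so the cells indexed by
  \<open>P k\<close> cover E with sum at most \<open>card (P k)\<close> times Q^(-ks). One large k
  makes both the diameters and the sum small.\<close>

lemma hausdorff_measure_null_if_grid:
  fixes E :: "real set" and Q :: int and P :: "nat \<Rightarrow> int set"
  assumes Q: "Q \<ge> 2" and s: "s > 0"
    and fin: "\<And>k. finite (P k)" and P: "\<And>k x. x \<in> E \<Longrightarrow> \<lfloor>of_int Q ^ k * x\<rfloor> \<in> P k"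
    and lim: "(\<lambda>k. real (card (P k)) / (of_int Q powr s) ^ k) \<longlonglongrightarrow> 0"
  shows "hausdorff_measure s E = 0"
proof (rule hausdorff_measure_eq_0I)
  fix \<delta> \<epsilon> :: real assume pos: "0 < \<delta>" "0 < \<epsilon>"
  have "(\<lambda>k. (1 / of_int Q :: real) ^ k) \<longlonglongrightarrow> 0"
    using Q by (intro LIMSEQ_realpow_zero) auto
  then have "\<forall>\<^sub>F k in sequentially. (1 / of_int Q :: real) ^ k < \<delta>"
    by (rule order_tendstoD) (use pos in auto)
  moreover have "\<forall>\<^sub>F k in sequentially. real (card (P k)) / (of_int Q powr s) ^ k < \<epsilon>"
    using lim by (rule order_tendstoD) (use pos in auto)
  ultimately have "\<forall>\<^sub>F k in sequentially. (1 / of_int Q :: real) ^ k < \<delta> \<and>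
      real (card (P k)) / (of_int Q powr s) ^ k < \<epsilon>"
    by eventually_elim auto
  then obtain k where k: "(1 / of_int Q :: real) ^ k < \<delta>"
      "real (card (P k)) / (of_int Q powr s) ^ k < \<epsilon>"
    using eventually_happens'[OF sequentially_bot] by blast
  define I where "I p = {x::real. \<lfloor>of_int Q ^ k * x\<rfloor> = p}" for p
  have dist_I: "dist x y \<le> (1 / of_int Q) ^ k" if "x \<in> I p" "y \<in> I p" for x y p
  proof -
    have "\<bar>of_int Q ^ k * x - of_int Q ^ k * y\<bar> \<le> 1"
      using that unfolding I_def by simp linarith
    then have "of_int Q ^ k * \<bar>x - y\<bar> \<le> 1"
      using Q by (simp add: abs_mult flip: right_diff_distrib)
    then show ?thesis
      using Q by (simp add: dist_real_def power_one_over divide_simps mult.commute)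
  qed
  have bdd_I: "bounded (I p)" for p
    using dist_I unfolding bounded_two_points by blast
  have diam_I: "diameter (I p) \<le> (1 / of_int Q) ^ k" for p
    using dist_I Q by (intro diameter_le) (auto simp: dist_norm)
  obtain f where f: "bij_betw f {..<card (P k)} (P k)"
    using bij_betw_from_nat_into_finite[OF fin] by blast
  \<comment> \<open>Empty sets pad the finite family to a sequence; \<open>diam_pow\<close> gives
    them 0.\<close>
  define U where "U i = (if i < card (P k) then I (f i) else {})" for i
  have "delta_cover \<delta> E U"
    unfolding delta_cover_def
  proof (intro conjI subsetI allI)
    fix x assume "x \<in> E"
    then obtain i where "i < card (P k)" "f i = \<lfloor>of_int Q ^ k * x\<rfloor>"
      using P f unfolding bij_betw_def by (metis imageE lessThan_iff)
    then have "x \<in> U i" by (auto simp: U_def I_def)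
    then show "x \<in> (\<Union>i. U i)" by blast
  next
    fix i
    show "bounded (U i)" using bdd_I by (simp add: U_def)
    show "diameter (U i) \<le> \<delta>" using diam_I[of "f i"] k(1) pos
      by (auto simp: U_def)
  qed
  moreover have "(\<Sum>i. diam_pow s (U i)) \<le> ennreal \<epsilon>"
  proof -
    have "diam_pow s (U i) \<le> ennreal (1 / (of_int Q powr s) ^ k)" for i
    proof -
      have "diameter (U i) powr s \<le> ((1 / of_int Q) ^ k) powr s"
        using diam_I[of "f i"] Q bdd_I[of "f i"] diameter_ge_0[of "I (f i)"] s
        by (intro powr_mono2) (auto simp: U_def)
      also have "((1 / of_int Q) ^ k) powr s = 1 / (of_int Q powr s) ^ k"
        using Q by (simp add: powr_power powr_divide power_one_over powr_realpow[symmetric] powr_powr mult.commute)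
      finally show ?thesis
        using s by (auto simp: diam_pow_def ennreal_leI)
    qed
    then have "(\<Sum>i<card (P k). diam_pow s (U i)) \<le> (\<Sum>i<card (P k). ennreal (1 / (of_int Q powr s) ^ k))"
      by (intro sum_mono)
    also have "\<dots> = ennreal (real (card (P k)) / (of_int Q powr s) ^ k)"
      by (subst sum_ennreal) (auto simp: field_simps)
    also have "\<dots> \<le> ennreal \<epsilon>"
      using k(2) by (intro ennreal_leI) auto
    finally show ?thesis
      by (subst suminf_finite[of "{..<card (P k)}"]) (auto simp: U_def diam_pow_def)
  qed
  ultimately show "\<exists>U. delta_cover \<delta> E U \<and> (\<Sum>i. diam_pow s (U i)) \<le> ennreal \<epsilon>"
    by blast
qed

lemma hausdorff_measure_unit_interval_null:
  assumes "s > 1"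
  shows "hausdorff_measure s {0..<1::real} = 0"
proof (rule hausdorff_measure_null_if_grid[of 2 s "\<lambda>k. {0..<2 ^ k}"])
  have "(2 :: real) powr s > 2 powr 1" using assms by (intro powr_less_mono) auto
  then have "(\<lambda>k. (2 / 2 powr s) ^ k) \<longlonglongrightarrow> (0::real)"
    by (intro LIMSEQ_realpow_zero) auto
  then show "(\<lambda>k. real (card {0..<2 ^ k :: int}) / (of_int 2 powr s) ^ k) \<longlonglongrightarrow> 0"
    by (simp add: power_divide nat_power_eq)
next
  fix k and x :: real assume "x \<in> {0..<1}"
  then have "2 ^ k * x < 2 ^ k" "0 \<le> 2 ^ k * x" by auto
  then show "\<lfloor>of_int 2 ^ k * x\<rfloor> \<in> {0..<2 ^ k}"
    by (auto simp: floor_less_iff)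
qed (use assms in simp_all)

section \<open>Base-Q digits and the orbit of \<open>T_map\<close>\<close>

lemma funpow_T_map:
  assumes "x \<in> {0..<1}"
  shows "(T_map b ^^ n) x = frac (of_int b ^ n * x)"
proof (induction n)
  case 0
  then show ?case using assms by (simp add: frac_unique_iff)
next
  case (Suc n)
  have "(T_map b ^^ Suc n) x = T_map b (frac (of_int b ^ n * x))"
    using Suc by simp
  also have "\<dots> = frac (of_int b * frac (of_int b ^ n * x))"
    by (rule T_map_def)
  also have "of_int b * frac (of_int b ^ n * x)
      = of_int b ^ Suc n * x + of_int (- b * \<lfloor>of_int b ^ n * x\<rfloor>)"
    by (simp add: frac_def algebra_simps)
  also have "frac \<dots> = frac (of_int b ^ Suc n * x)"
    by (rule frac_add_of_int_right)
  finally show ?case .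
qed

text \<open>Indices start at 0, so digit \<open>k\<close> belongs to Q^-(k+1). For x in [0,1) the
  form with \<open>frac\<close> makes it the leading digit of the k-th iterate of
  \<open>T_map Q\<close>, which is how the dynamics meets the digits.\<close>

definition base_digit :: "int \<Rightarrow> real \<Rightarrow> nat \<Rightarrow> int" where
  "base_digit Q x k = \<lfloor>of_int Q * frac (of_int Q ^ k * x)\<rfloor>"

lemma base_digit_eq:
  "base_digit Q x k = \<lfloor>of_int Q ^ Suc k * x\<rfloor> - Q * \<lfloor>of_int Q ^ k * x\<rfloor>"
proof -
  have "of_int Q * frac (of_int Q ^ k * x)
      = of_int Q ^ Suc k * x - of_int (Q * \<lfloor>of_int Q ^ k * x\<rfloor>)"
    by (simp add: frac_def algebra_simps)
  then show ?thesis unfolding base_digit_def by (simp only: floor_diff_of_int)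
qed

lemma base_digit_range:
  assumes "Q > 0"
  shows "base_digit Q x k \<in> {0..<Q}"
proof -
  have "of_int Q * frac (of_int Q ^ k * x) < of_int Q"
    using frac_lt_1[of "of_int Q ^ k * x"] assms by simp
  then show ?thesis
    using assms unfolding base_digit_def by (auto simp: floor_less_iff)
qed

text \<open>Passing to level k + 1 appends one digit in [0,Q) to the cell index, and
  \<open>div\<close> and \<open>mod\<close> by Q undo this. Thus lying in one Q-adic cell of level k
  means sharing the first k digits, which turns digit conditions into metric ones.\<close>

lemma floor_eq_iff_base_digits:
  assumes "Q > 0" "x \<in> {0..<1}" "y \<in> {0..<1}"
  shows "\<lfloor>of_int Q ^ k * x\<rfloor> = \<lfloor>of_int Q ^ k * y\<rfloor>
    \<longleftrightarrow> (\<forall>j<k. base_digit Q x j = base_digit Q y j)"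
proof (induction k)
  case 0
  have "\<lfloor>x\<rfloor> = 0" "\<lfloor>y\<rfloor> = 0" using assms by (auto simp: floor_eq_iff)
  then show ?case by simp
next
  case (Suc k)
  have split: "\<lfloor>of_int Q ^ Suc k * z\<rfloor> = base_digit Q z k + Q * \<lfloor>of_int Q ^ k * z\<rfloor>" for z
    by (simp add: base_digit_eq)
  have d: "base_digit Q z k = \<lfloor>of_int Q ^ Suc k * z\<rfloor> mod Q"
    "\<lfloor>of_int Q ^ k * z\<rfloor> = \<lfloor>of_int Q ^ Suc k * z\<rfloor> div Q" for z
    using base_digit_range[of Q z k] assms(1) unfolding split by auto
  have "\<lfloor>of_int Q ^ Suc k * x\<rfloor> = \<lfloor>of_int Q ^ Suc k * y\<rfloor> \<longleftrightarrow>
      base_digit Q x k = base_digit Q y k \<and> \<lfloor>of_int Q ^ k * x\<rfloor> = \<lfloor>of_int Q ^ k * y\<rfloor>"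
    (is "?l \<longleftrightarrow> ?r")
  proof
    assume e: ?l
    show ?r unfolding d[of x] d[of y] e by simp
  qed (simp only: split)
  then show ?case
    unfolding less_Suc_eq Suc.IH by blast
qed

definition digit_val :: "int \<Rightarrow> (nat \<Rightarrow> int) \<Rightarrow> real" where
  "digit_val Q d = (\<Sum>j. of_int (d j) / of_int Q ^ Suc j)"

text \<open>Excluding the digit \<open>Q - 1\<close> makes expansions unique, so digits can be read off the value.\<close>
lemma digit_val_aux:
  assumes "Q \<ge> 2" "\<And>j. d j \<in> {0..Q - 2}"
  shows summable_digit_val: "summable (\<lambda>j. of_int (d j) / of_int Q ^ Suc j :: real)" (is "summable ?f")
    and digit_val_in: "digit_val Q d \<in> {0..<1}"
proof -
  \<comment> \<open>The series is compared with the one whose digits all equal Q - 2. Its value (Q -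
    2)/(Q - 1) is strictly below 1, whereas constant digits Q - 1 would give exactly 1.\<close>
  have "(\<lambda>j. (of_int (Q - 2) / of_int Q) * (1 / of_int Q) ^ j) sums
      ((of_int (Q - 2) / of_int Q) * (1 / (1 - 1 / of_int Q)) :: real)"
    using assms(1) by (intro sums_mult geometric_sums) auto
  moreover have fn: "(of_int (Q - 2) / of_int Q) * (1 / of_int Q) ^ j = (of_int (Q - 2) / of_int Q ^ Suc j :: real)" for j
    by (simp add: power_one_over)
  moreover have "(of_int (Q - 2) / of_int Q) * (1 / (1 - 1 / of_int Q)) = (of_int (Q - 2) / of_int (Q - 1) :: real)"
  proof -
    have "1 - 1 / of_int Q = (of_int (Q - 1) / of_int Q :: real)"
      using assms(1) by (simp add: diff_divide_distrib)
    then show ?thesis using assms(1) by simp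
  qed
  ultimately have g: "(\<lambda>j. of_int (Q - 2) / of_int Q ^ Suc j) sums (of_int (Q - 2) / of_int (Q - 1) :: real)"
    by (simp only: fn)
  have le: "?f j \<le> of_int (Q - 2) / of_int Q ^ Suc j" for j
  proof (rule divide_right_mono)
    show "real_of_int (d j) \<le> of_int (Q - 2)" using assms(2)[of j] by (subst of_int_le_iff) auto
  qed (use assms(1) in auto)
  have ge: "0 \<le> ?f j" for j
    using assms(1) assms(2)[of j] by auto
  show sm: "summable ?f"
    using le ge by (intro summable_comparison_test'[OF sums_summable[OF g], of 0]) (simp only: real_norm_def abs_of_nonneg)
  have "digit_val Q d \<le> of_int (Q - 2) / of_int (Q - 1)"
    unfolding digit_val_def sums_unique[OF g] using sm g
    by (intro suminf_le le sums_summable[OF g]) auto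
  also have "\<dots> < 1" using assms(1) by simp
  finally show "digit_val Q d \<in> {0..<1}"
    using suminf_nonneg[OF sm ge] by (simp add: digit_val_def)
qed

lemma digit_val_Suc:
  assumes "Q \<ge> 2" "\<And>j. d j \<in> {0..Q - 2}"
  shows "of_int Q * digit_val Q d = of_int (d 0) + digit_val Q (\<lambda>j. d (Suc j))"
proof -
  have sm: "summable (\<lambda>j. of_int (d (Suc j)) / of_int Q ^ Suc j :: real)"
    using assms by (intro summable_digit_val) auto
  have "digit_val Q d = of_int (d 0) / of_int Q + (\<Sum>j. of_int (d (Suc j)) / of_int Q ^ Suc (Suc j))"
    unfolding digit_val_def using suminf_split_head[OF summable_digit_val[where d = d, OF assms]] by simp
  also have "(\<Sum>j. real_of_int (d (Suc j)) / of_int Q ^ Suc (Suc j)) = digit_val Q (\<lambda>j. d (Suc j)) / of_int Q"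
    unfolding digit_val_def using suminf_divide[OF sm, of "of_int Q"]
    by (simp add: mult_ac)
  finally show ?thesis using assms(1) by (simp add: field_simps)
qed

text \<open>Multiplying by Q moves the first digit into the integer part, since the remaining series
  lies in [0,1); hence \<open>T_map Q\<close> acts as the shift on digit sequences.\<close>

lemma frac_digit_val:
  assumes "Q \<ge> 2" "\<And>j. d j \<in> {0..Q - 2}"
  shows "frac (of_int Q ^ k * digit_val Q d) = digit_val Q (\<lambda>j. d (j + k))"
proof -
  have "(T_map Q ^^ k) (digit_val Q d) = digit_val Q (\<lambda>j. d (j + k))"
  proof (induction k)
    case (Suc k)
    have "T_map Q (digit_val Q (\<lambda>j. d (j + k))) = frac (of_int (d k) + digit_val Q (\<lambda>j. d (Suc j + k)))"
      unfolding T_map_def by (subst digit_val_Suc) (use assms in auto)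
    also have "\<dots> = digit_val Q (\<lambda>j. d (Suc j + k))"
      using digit_val_in[of Q "\<lambda>j. d (Suc j + k)"] assms by (simp add: frac_unique_iff)
    finally show ?case using Suc.IH by simp
  qed simp
  then show ?thesis
    using funpow_T_map digit_val_in assms by metis
qed

lemma base_digit_digit_val:
  assumes "Q \<ge> 2" "\<And>j. d j \<in> {0..Q - 2}"
  shows "base_digit Q (digit_val Q d) k = d k"
proof -
  have "of_int Q * frac (of_int Q ^ k * digit_val Q d) = of_int (d k) + digit_val Q (\<lambda>j. d (Suc j + k))"
    unfolding frac_digit_val[OF assms] by (subst digit_val_Suc) (use assms in auto)
  moreover have "digit_val Q (\<lambda>j. d (Suc j + k)) \<in> {0..<1}"
    using assms by (intro digit_val_in) auto
  ultimately show ?thesis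
    unfolding base_digit_def by (simp add: floor_eq_iff)
qed

section \<open>Lower bound: sets with at least q admissible digits at each place\<close>

lemma int_set_subset_pair:
  fixes S :: "int set"
  assumes "\<And>x y. x \<in> S \<Longrightarrow> y \<in> S \<Longrightarrow> \<bar>x - y\<bar> \<le> 1"
  obtains p where "S \<subseteq> {p, p + 1}"
proof (cases "S = {}")
  case False
  then obtain x where "x \<in> S" by auto
  show ?thesis
  proof (cases "x - 1 \<in> S")
    case True
    have "y \<in> {x - 1, x - 1 + 1}" if "y \<in> S" for y
      using assms[OF that \<open>x \<in> S\<close>] assms[OF that True] by auto
    then show ?thesis using that[of "x - 1"] by blast
  next
    case False
    have "y \<in> {x, x + 1}" if "y \<in> S" for y
      using assms[OF that \<open>x \<in> S\<close>] that False by (cases "y = x - 1") auto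
    then show ?thesis using that[of x] by blast
  qed
qed (use that in auto)

text \<open>Floors of reals less than 1 apart differ by at most 1. This gives the factor 2 in the
  measure estimate for covers and, later, the two digits excluded by each short ball.\<close>

lemma floor_image_subset_pair:
  fixes S :: "real set" and c :: real
  assumes "\<And>x y. x \<in> S \<Longrightarrow> y \<in> S \<Longrightarrow> c * \<bar>x - y\<bar> < 1" "c > 0"
  obtains p where "(\<lambda>x. \<lfloor>c * x\<rfloor>) ` S \<subseteq> {p, p + 1}"
proof (rule int_set_subset_pair)
  fix a b assume "a \<in> (\<lambda>x. \<lfloor>c * x\<rfloor>) ` S" "b \<in> (\<lambda>x. \<lfloor>c * x\<rfloor>) ` S"
  then obtain x y where xy: "x \<in> S" "y \<in> S" "a = \<lfloor>c * x\<rfloor>" "b = \<lfloor>c * y\<rfloor>" by auto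
  have "\<bar>c * x - c * y\<bar> < 1"
    using assms(1)[OF xy(1,2)] assms(2) by (simp add: abs_mult flip: right_diff_distrib)
  then show "\<bar>a - b\<bar> \<le> 1" using xy(3,4) by linarith
qed (use that in blast)

lemma floor_preimage_emeasure:
  fixes q :: int
  assumes "q > 0"
  shows "{y::real. \<lfloor>of_int q ^ k * y\<rfloor> = p} \<in> sets lborel"
    and "emeasure lborel {y::real. \<lfloor>of_int q ^ k * y\<rfloor> = p} = ennreal (1 / of_int q ^ k)"
proof -
  have "{y::real. \<lfloor>of_int q ^ k * y\<rfloor> = p} = {of_int p / of_int q ^ k..<(of_int p + 1) / of_int q ^ k}"
    using assms by (auto simp: floor_eq_iff field_simps)
  then show "{y::real. \<lfloor>of_int q ^ k * y\<rfloor> = p} \<in> sets lborel"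
    and "emeasure lborel {y::real. \<lfloor>of_int q ^ k * y\<rfloor> = p} = ennreal (1 / of_int q ^ k)"
    using assms by (auto simp: divide_right_mono diff_divide_distrib[symmetric])
qed

text \<open>A mass distribution argument: \<open>h\<close> carries Lebesgue measure on [0,1) to E,
  so a cover of E by sets of diameter below 1 pulls back to a cover of [0,1). Its sum of
  \<open>diam_pow\<close> is therefore at least 1/(2q).\<close>

lemma hausdorff_measure_restricted_digits_nonzero:
  fixes Q :: int and A :: "nat \<Rightarrow> int set" and E :: "real set"
  assumes Q: "Q \<ge> 2" and q: "q \<ge> 2" and s: "s \<ge> 0" "of_int Q powr s \<le> real q"
    and A: "\<And>j. A j \<subseteq> {0..Q - 2}" "\<And>j. q \<le> card (A j)"
    and E: "\<And>x. x \<in> {0..<1} \<Longrightarrow> (\<And>j. base_digit Q x j \<in> A j) \<Longrightarrow> x \<in> E"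
  shows "hausdorff_measure s E \<noteq> 0"
proof
  assume null: "hausdorff_measure s E = 0"
  have "\<exists>f. inj_on f {0..<int q} \<and> f ` {0..<int q} \<subseteq> A j" for j
  proof -
    have "finite (A j)" by (rule finite_subset[OF A(1)]) simp
    then show ?thesis using inj_on_iff_card_le[of "{0..<int q}" "A j"] A(2)[of j] card_le_inj[of "{0..<int q}" "A j"] by auto
  qed
  then obtain \<phi> where inj: "\<And>j. inj_on (\<phi> j) {0..<int q}" and sub: "\<And>j. \<phi> j ` {0..<int q} \<subseteq> A j"
    by metis
  define h where "h y = digit_val Q (\<lambda>j. \<phi> j (base_digit (int q) y j))" for y
  have qdig: "base_digit (int q) y j \<in> {0..<int q}" for y j
    using q by (intro base_digit_range) auto
  have dA: "\<phi> j (base_digit (int q) y j) \<in> A j" for y j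
    using qdig sub by blast
  then have dQ: "\<phi> j (base_digit (int q) y j) \<in> {0..Q - 2}" for y j
    using A(1) by blast
  have h01: "h y \<in> {0..<1}" for y
    unfolding h_def by (rule digit_val_in[OF Q dQ])
  have hdig: "base_digit Q (h y) j = \<phi> j (base_digit (int q) y j)" for y j
    unfolding h_def by (rule base_digit_digit_val[OF Q dQ])
  have hE: "h y \<in> E" for y
    using h01 hdig dA by (intro E) auto
  \<comment> \<open>Injectivity of each \<open>\<phi> j\<close> lets the base-q digits of
    \<open>y\<close> be recovered from the base-Q digits of \<open>h y\<close>, place by
    place.\<close>
  have hfloor: "\<lfloor>real q ^ k * y\<rfloor> = \<lfloor>real q ^ k * y'\<rfloor>"
    if "\<lfloor>of_int Q ^ k * h y\<rfloor> = \<lfloor>of_int Q ^ k * h y'\<rfloor>" "y \<in> {0..<1}" "y' \<in> {0..<1}" for k y y'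
  proof -
    have "\<forall>j<k. base_digit (int q) y j = base_digit (int q) y' j"
      using that(1) floor_eq_iff_base_digits[of Q "h y" "h y'" k] h01 Q qdig inj_onD[OF inj]
      unfolding hdig by auto
    then show ?thesis
      using floor_eq_iff_base_digits[of "int q" y y' k] that q by simp
  qed
  \<comment> \<open>Measurability of \<open>h\<close> is avoided by enclosing preimages in Borel
    sets: the points sent into one Q-adic cell of level k lie in a single q-adic cell of that
    level.\<close>
  have cell: "\<exists>M \<in> sets lborel. {y \<in> {0..<1}. \<lfloor>of_int Q ^ k * h y\<rfloor> = p} \<subseteq> M
      \<and> emeasure lborel M \<le> ennreal (1 / real q ^ k)" for k p
  proof (cases "\<exists>y\<in>{0..<1}. \<lfloor>of_int Q ^ k * h y\<rfloor> = p")
    case True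
    then obtain y where y: "y \<in> {0..<1}" "\<lfloor>of_int Q ^ k * h y\<rfloor> = p" by blast
    define M where "M = {z::real. \<lfloor>of_int (int q) ^ k * z\<rfloor> = \<lfloor>real q ^ k * y\<rfloor>}"
    have "M \<in> sets lborel" "emeasure lborel M \<le> ennreal (1 / real q ^ k)"
      using floor_preimage_emeasure[of "int q" k "\<lfloor>real q ^ k * y\<rfloor>"] q unfolding M_def by simp_all
    moreover have "{y \<in> {0..<1}. \<lfloor>of_int Q ^ k * h y\<rfloor> = p} \<subseteq> M"
    proof
      fix z assume "z \<in> {y \<in> {0..<1}. \<lfloor>of_int Q ^ k * h y\<rfloor> = p}"
      then have "\<lfloor>real q ^ k * z\<rfloor> = \<lfloor>real q ^ k * y\<rfloor>"
        using y by (intro hfloor) simp_all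
      then show "z \<in> M" by (simp add: M_def)
    qed
    ultimately show ?thesis by blast
  next
    case False
    then show ?thesis by (intro bexI[of _ "{}"]) auto
  qed
  have cover: "\<exists>M \<in> sets lborel. {y \<in> {0..<1}. h y \<in> U} \<subseteq> M
      \<and> emeasure lborel M \<le> ennreal (2 * real q) * diam_pow s U"
    if U: "bounded U" "diameter U < 1" for U
  proof (cases "diameter U = 0")
    case True
    \<comment> \<open>Diameter 0 fits no scale k. Here the preimage has at most one point, since
      equal images force equal q-adic cells at every level.\<close>
    have single: "y = y'" if yy: "y \<in> {0..<1}" "h y \<in> U" "y' \<in> {0..<1}" "h y' \<in> U" for y y'
    proof (rule ccontr)
      assume "y \<noteq> y'"
      have "h y = h y'"
        using diameter_bounded_bound[OF U(1) yy(2,4)] True by simp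
      then have fl: "\<lfloor>real q ^ k * y\<rfloor> = \<lfloor>real q ^ k * y'\<rfloor>" for k
        using hfloor yy by metis
      have "real q ^ k * \<bar>y - y'\<bar> \<le> 1" for k
      proof -
        have "\<bar>real q ^ k * y - real q ^ k * y'\<bar> \<le> 1" using fl[of k] by linarith
        then show ?thesis by (simp add: abs_mult flip: right_diff_distrib)
      qed
      moreover obtain k where "1 / \<bar>y - y'\<bar> < real q ^ k"
        using real_arch_pow[of "real q"] q by auto
      ultimately show False using \<open>y \<noteq> y'\<close> by (simp add: field_simps) (meson not_le)
    qed
    have "\<exists>z. {y \<in> {0..<1}. h y \<in> U} \<subseteq> {z}"
      using single by (cases "{y \<in> {0..<1}. h y \<in> U} = {}") auto
    then obtain z where "{y \<in> {0..<1}. h y \<in> U} \<subseteq> {z}" ..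
    then show ?thesis by (intro bexI[of _ "{z}"]) auto
  next
    case False
    then have pos: "0 < diameter U" using diameter_ge_0[OF U(1)] by simp
    \<comment> \<open>The scale of U comes from the least exponent m with Q^-m at most the diameter;
      \<open>diameter U < 1\<close> rules out m = 0.\<close>
    have "\<exists>k. (1 / of_int Q) ^ Suc k \<le> diameter U \<and> diameter U < (1 / of_int Q) ^ k"
    proof -
      have "\<exists>k. (1 / of_int Q) ^ k \<le> diameter U"
        using real_arch_pow_inv[OF pos, of "1 / of_int Q"] Q by (auto intro: less_imp_le)
      then obtain m where m: "(1 / of_int Q) ^ m \<le> diameter U"
        and least: "\<And>k. k < m \<Longrightarrow> \<not> (1 / of_int Q) ^ k \<le> diameter U"
        using exists_least_iff[of "\<lambda>k. (1 / of_int Q) ^ k \<le> diameter U"] by auto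
      have "m \<noteq> 0" using m U(2) by (intro notI) simp
      then obtain k where "m = Suc k" using not0_implies_Suc by blast
      then show ?thesis using m least[of k] by (intro exI[of _ k]) auto
    qed
    then obtain k where k: "(1 / of_int Q) ^ Suc k \<le> diameter U" "diameter U < (1 / of_int Q) ^ k"
      by blast
    have "of_int Q ^ k * \<bar>x - y\<bar> < 1" if "x \<in> U" "y \<in> U" for x y
    proof -
      have "\<bar>x - y\<bar> < (1 / of_int Q) ^ k"
        using diameter_bounded_bound[OF U(1) that] k(2) by (simp add: dist_real_def)
      then show ?thesis using Q by (simp add: power_one_over field_simps)
    qed
    then obtain p where p: "(\<lambda>x. \<lfloor>of_int Q ^ k * x\<rfloor>) ` U \<subseteq> {p, p + 1}"
      using floor_image_subset_pair[of U "of_int Q ^ k"] Q by auto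
    from cell[of k "p"] obtain M where M: "M \<in> sets lborel" "{y \<in> {0..<1}. \<lfloor>of_int Q ^ k * h y\<rfloor> = p} \<subseteq> M"
      "emeasure lborel M \<le> ennreal (1 / real q ^ k)"
      by (elim bexE conjE)
    from cell[of k "p + 1"] obtain N where N: "N \<in> sets lborel" "{y \<in> {0..<1}. \<lfloor>of_int Q ^ k * h y\<rfloor> = p + 1} \<subseteq> N"
      "emeasure lborel N \<le> ennreal (1 / real q ^ k)"
      by (elim bexE conjE)
    have "emeasure lborel (M \<union> N) \<le> ennreal (1 / real q ^ k) + ennreal (1 / real q ^ k)"
      using emeasure_subadditive[OF M(1) N(1)] add_mono[OF M(3) N(3)] by (rule order_trans)
    \<comment> \<open>The two cells have total length 2 q^-k. Writing it with exponent k + 1 costs a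
      factor q but matches the lower bound Q^-(k+1) for the diameter, and q^-1 is at most
      Q^-s.\<close>
    also have "\<dots> = ennreal (2 * real q * (1 / real q) ^ Suc k)"
      using q by (simp add: power_one_over field_simps flip: ennreal_plus)
    also have "\<dots> \<le> ennreal (2 * real q * diameter U powr s)"
    proof (intro ennreal_leI mult_left_mono)
      have "(1 / real q) ^ Suc k \<le> (1 / of_int Q powr s) ^ Suc k"
        using s q Q by (intro power_mono divide_left_mono) auto
      also have "\<dots> = ((1 / of_int Q) ^ Suc k) powr s"
        using Q by (simp add: powr_divide power_one_over powr_realpow[symmetric] powr_powr mult.commute del: power_Suc)
      also have "\<dots> \<le> diameter U powr s"
        using k(1) s Q by (intro powr_mono2) auto
      finally show "(1 / real q) ^ Suc k \<le> diameter U powr s" .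
    qed simp
    also have "\<dots> = ennreal (2 * real q) * diam_pow s U"
      using pos by (auto simp: diam_pow_def ennreal_mult)
    finally have "emeasure lborel (M \<union> N) \<le> ennreal (2 * real q) * diam_pow s U" .
    moreover have "{y \<in> {0..<1}. h y \<in> U} \<subseteq> M \<union> N"
      using M(2) N(2) p by blast
    ultimately show ?thesis using M(1) N(1) by blast
  qed
  \<comment> \<open>The scale 1/2 keeps all diameters below 1, and the bound 1/(2q) makes the
    pulled-back cover of [0,1) have total measure below 1.\<close>
  obtain U where U: "delta_cover (1/2) E U" "(\<Sum>i. diam_pow s (U i)) < ennreal (1 / (2 * real q))"
    using hausdorff_measure_eq_0D[OF null, of "1/2" "1 / (2 * real q)"] q by auto
  have "\<exists>M. M \<in> sets lborel \<and> {y \<in> {0..<1}. h y \<in> U i} \<subseteq> M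
      \<and> emeasure lborel M \<le> ennreal (2 * real q) * diam_pow s (U i)" for i
    unfolding Bex_def[symmetric]
  proof (rule cover)
    show "bounded (U i)" "diameter (U i) < 1"
      using U(1) unfolding delta_cover_def by (auto intro: le_less_trans[of _ "1/2"])
  qed
  then have "\<forall>i. \<exists>M. M \<in> sets lborel \<and> {y \<in> {0..<1}. h y \<in> U i} \<subseteq> M
      \<and> emeasure lborel M \<le> ennreal (2 * real q) * diam_pow s (U i)" ..
  from choice[OF this] obtain M where M: "\<And>i. M i \<in> sets lborel"
    "\<And>i. {y \<in> {0..<1}. h y \<in> U i} \<subseteq> M i"
    "\<And>i. emeasure lborel (M i) \<le> ennreal (2 * real q) * diam_pow s (U i)"
    by blast
  have "{0..<1} \<subseteq> (\<Union>i. M i)"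
  proof
    fix y :: real assume "y \<in> {0..<1}"
    moreover have "h y \<in> (\<Union>i. U i)" using hE U(1) unfolding delta_cover_def by blast
    ultimately show "y \<in> (\<Union>i. M i)" using M(2) by blast
  qed
  then have "emeasure lborel {0..<1::real} \<le> emeasure lborel (\<Union>i. M i)"
    using M(1) by (intro emeasure_mono) auto
  also have "\<dots> \<le> (\<Sum>i. emeasure lborel (M i))"
    using M(1) by (intro emeasure_subadditive_countably) auto
  also have "\<dots> \<le> (\<Sum>i. ennreal (2 * real q) * diam_pow s (U i))"
    using M(3) by (intro suminf_le) auto
  also have "\<dots> = ennreal (2 * real q) * (\<Sum>i. diam_pow s (U i))"
    by simp
  also have "\<dots> < ennreal (2 * real q) * ennreal (1 / (2 * real q))"
    using U(2) q by (intro ennreal_mult_strict_left_mono) auto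
  also have "\<dots> = 1"
    using q by (simp flip: ennreal_mult)
  finally show False by simp
qed

section \<open>Upper bound from one forbidden digit per place, and part (ii)\<close>

lemma hausdorff_measure_forbidden_digits_null:
  fixes Q :: int and a :: "nat \<Rightarrow> int"
  assumes Q: "Q \<ge> 2" and s: "s > 0" "of_int (Q - 1) < of_int Q powr s"
    and E: "E \<subseteq> {0..<1}" and a: "\<And>k. k \<ge> N \<Longrightarrow> a k \<in> {0..<Q}"
    and avoid: "\<And>x k. x \<in> E \<Longrightarrow> k \<ge> N \<Longrightarrow> base_digit Q x k \<noteq> a k"
  shows "hausdorff_measure s E = 0"
proof -
  define P where "P k = (\<lambda>x. \<lfloor>of_int Q ^ k * x\<rfloor>) ` E" for k
  have P_sub: "P k \<subseteq> {0..<Q ^ k}" for k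
  proof
    fix p assume "p \<in> P k"
    then obtain x where x: "x \<in> E" "p = \<lfloor>of_int Q ^ k * x\<rfloor>" by (auto simp: P_def)
    have "0 \<le> of_int Q ^ k * x" "of_int Q ^ k * x < of_int (Q ^ k)" using E x Q by auto
    then show "p \<in> {0..<Q ^ k}" using x(2) by (auto simp: floor_less_iff)
  qed
  then have fin: "finite (P k)" for k by (rule finite_subset) simp
  \<comment> \<open>Up to level N all cells may occur; afterwards each cell has at most Q - 1
    children meeting E. Against Q^(s k) this decays geometrically because Q - 1 < Q^s.\<close>
  have card_P: "card (P (i + N)) \<le> nat Q ^ N * nat (Q - 1) ^ i" for i
  proof (induction i)
    case 0
    have "card (P N) \<le> card {0..<Q ^ N}" by (intro card_mono P_sub) simp
    then show ?case using Q by (simp add: nat_power_eq)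
  next
    case (Suc i)
    have "P (Suc i + N) \<subseteq> (\<lambda>(p, d). d + Q * p) ` (P (i + N) \<times> ({0..<Q} - {a (i + N)}))"
    proof
      fix p assume "p \<in> P (Suc i + N)"
      then obtain x where x: "x \<in> E" "p = \<lfloor>of_int Q ^ Suc (i + N) * x\<rfloor>" by (auto simp: P_def)
      then have "p = base_digit Q x (i + N) + Q * \<lfloor>of_int Q ^ (i + N) * x\<rfloor>"
        by (simp only: base_digit_eq)
      moreover have "base_digit Q x (i + N) \<in> {0..<Q} - {a (i + N)}"
        using avoid[OF x(1)] base_digit_range[of Q x "i + N"] Q by auto
      moreover have "\<lfloor>of_int Q ^ (i + N) * x\<rfloor> \<in> P (i + N)"
        using x(1) unfolding P_def by (rule imageI)
      ultimately show "p \<in> (\<lambda>(p, d). d + Q * p) ` (P (i + N) \<times> ({0..<Q} - {a (i + N)}))"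
        by (intro image_eqI[of _ _ "(\<lfloor>of_int Q ^ (i + N) * x\<rfloor>, base_digit Q x (i + N))"]) auto
    qed
    then have "card (P (Suc i + N)) \<le> card (P (i + N) \<times> ({0..<Q} - {a (i + N)}))"
      using fin by (intro surj_card_le) auto
    also have "\<dots> = card (P (i + N)) * nat (Q - 1)"
      using a[of "i + N"] Q by (simp add: card_cartesian_product nat_diff_distrib)
    also have "\<dots> \<le> nat Q ^ N * nat (Q - 1) ^ i * nat (Q - 1)"
      using Suc.IH by (intro mult_right_mono) auto
    finally show ?case by (simp add: mult_ac)
  qed
  let ?S = "of_int Q powr s :: real"
  have Spos: "?S > 0" using Q by simp
  have lim: "(\<lambda>i. of_int Q ^ N / ?S ^ N * (of_int (Q - 1) / ?S) ^ i) \<longlonglongrightarrow> 0"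
    using s Q Spos by (intro tendsto_mult_right_zero LIMSEQ_realpow_zero) auto
  have bound: "norm (real (card (P (i + N))) / ?S ^ (i + N))
      \<le> of_int Q ^ N / ?S ^ N * (of_int (Q - 1) / ?S) ^ i" for i
  proof -
    have "real (card (P (i + N))) \<le> real (nat Q ^ N * nat (Q - 1) ^ i)"
      by (rule of_nat_mono[OF card_P])
    also have "\<dots> = of_int Q ^ N * of_int (Q - 1) ^ i"
      using Q by (simp add: of_nat_nat)
    finally have "real (card (P (i + N))) / ?S ^ (i + N) \<le> of_int Q ^ N * of_int (Q - 1) ^ i / ?S ^ (i + N)"
      using Spos by (intro divide_right_mono) auto
    then show ?thesis by (simp add: power_add power_divide mult_ac)
  qed
  have "(\<lambda>i. real (card (P (i + N))) / ?S ^ (i + N)) \<longlonglongrightarrow> 0"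
    by (rule Lim_null_comparison[OF always_eventually[OF allI[OF bound]] lim])
  then have "(\<lambda>k. real (card (P k)) / ?S ^ k) \<longlonglongrightarrow> 0"
    by (rule LIMSEQ_offset[where k = N and f = "\<lambda>k. real (card (P k)) / ?S ^ k"])
  moreover have "\<lfloor>of_int Q ^ k * x\<rfloor> \<in> P k" if "x \<in> E" for k x
    unfolding P_def using that by (rule imageI)
  ultimately show ?thesis
    using Q s(1) fin by (intro hausdorff_measure_null_if_grid[of Q s P])
qed

text \<open>Since (b^m)^k = b^(m k), the k-th digit in base b^m is read from the base-b orbit at
  time m k. Part (ii) looks only at these times.\<close>

lemma base_digit_power:
  "base_digit (b ^ m) x k = \<lfloor>of_int (b ^ m) * frac (of_int b ^ (m * k) * x)\<rfloor>"
  by (simp add: base_digit_def power_mult)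

lemma open_ball_01_contains_cell:
  fixes Q :: int
  assumes "open_ball_01 B" "Q > 0" "2 / of_int Q < diameter B"
  shows "\<exists>a\<in>{0..<Q}. \<forall>z. \<lfloor>of_int Q * z\<rfloor> = a \<longrightarrow> z \<in> B"
proof -
  obtain c r where B: "B = ball c r \<inter> {0..<1}" and r: "r > 0" and c: "c \<in> {0..<1}"
    using assms(1) unfolding open_ball_01_def by blast
  have "\<exists>u\<in>B. \<exists>v\<in>B. 2 / of_int Q < \<bar>u - v\<bar>"
  proof (rule ccontr)
    assume "\<not> ?thesis"
    then have "diameter B \<le> 2 / of_int Q"
      using assms(2) by (intro diameter_le) (auto simp: not_less)
    then show False using assms(3) by simp
  qed
  then obtain u' v' where "u' \<in> B" "v' \<in> B" "2 / of_int Q < \<bar>u' - v'\<bar>" by blast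
  then obtain u v where uv: "u \<in> B" "v \<in> B" "2 / of_int Q < v - u"
    using that[of u' v'] that[of v' u'] by (simp add: abs_if split: if_splits)
  \<comment> \<open>This is the first cell entirely to the right of \<open>u\<close>. It ends at
    most 2/Q after \<open>u\<close>, hence before \<open>v\<close>, and B is an interval.\<close>
  define a where "a = \<lfloor>of_int Q * u\<rfloor> + 1"
  have a: "of_int Q * u < of_int a" "of_int a \<le> of_int Q * u + 1" by (auto simp: a_def)
  have Qv: "of_int Q * u + 2 < of_int Q * v" using uv(3) assms(2) by (simp add: field_simps)
  have u0: "0 \<le> of_int Q * u" and v1: "of_int Q * v < of_int Q"
    using uv(1,2) assms(2) B by auto
  have "z \<in> B" if "\<lfloor>of_int Q * z\<rfloor> = a" for z
  proof -
    have "of_int a \<le> of_int Q * z" "of_int Q * z < of_int a + 1" using that by linarith+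
    then have "of_int Q * u < of_int Q * z" "of_int Q * z < of_int Q * v" using a Qv by linarith+
    then have "u < z" "z < v" using assms(2) by auto
    then show ?thesis using uv(1,2) B by (auto simp: dist_real_def)
  qed
  moreover have "0 \<le> a" "a < Q" using a u0 v1 Qv by linarith+
  ultimately show ?thesis by (intro bexI[of _ a]) simp_all
qed

lemma hausdorff_dim_K_set_less_1:
  fixes b :: int and B :: "nat \<Rightarrow> real set"
  assumes b: "b \<ge> 2" and B: "\<And>n. open_ball_01 (B n)"
    and \<epsilon>: "\<epsilon> > 0" "\<forall>\<^sub>F n in sequentially. \<epsilon> < diameter (B n)"
  shows "hausdorff_dim (K_set b B) < 1"
proof -
  obtain N0 where N0: "\<And>n. n \<ge> N0 \<Longrightarrow> \<epsilon> < diameter (B n)"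
    using \<epsilon>(2) unfolding eventually_sequentially by blast
  obtain m0 where "2 / \<epsilon> < of_int b ^ m0"
    using real_arch_pow[of "of_int b" "2 / \<epsilon>"] b by auto
  also have "(of_int b :: real) ^ m0 \<le> of_int b ^ Suc (Suc m0)" using b by (intro power_increasing) auto
  finally have "2 / \<epsilon> < of_int b ^ Suc (Suc m0)" .
  \<comment> \<open>An exponent of at least 2 gives Q at least 4, so the logarithms defining
    \<open>s\<close> are positive, and it ensures that m k is at least k.\<close>
  then obtain m where m: "2 / \<epsilon> < of_int b ^ m" "m \<ge> 2"
    using that[of "Suc (Suc m0)"] by simp
  define Q where "Q = b ^ m"
  have "(2::int) ^ 2 \<le> 2 ^ m" using m(2) by (intro power_increasing) auto
  also have "\<dots> \<le> Q" unfolding Q_def using b by (intro power_mono) auto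
  finally have Q: "Q \<ge> 4" by simp
  have "2 / of_int Q < \<epsilon>" using m(1) \<epsilon>(1) b by (simp add: Q_def field_simps)
  then have "\<exists>a\<in>{0..<Q}. \<forall>z. \<lfloor>of_int Q * z\<rfloor> = a \<longrightarrow> z \<in> B n" if "n \<ge> N0" for n
    using Q N0[OF that] by (intro open_ball_01_contains_cell B) auto
  then have "\<forall>n. \<exists>a. n \<ge> N0 \<longrightarrow> a \<in> {0..<Q} \<and> (\<forall>z. \<lfloor>of_int Q * z\<rfloor> = a \<longrightarrow> z \<in> B n)"
    by blast
  from choice[OF this] obtain a where a: "\<And>n. n \<ge> N0 \<Longrightarrow> a n \<in> {0..<Q}"
    and aB: "\<And>n z. n \<ge> N0 \<Longrightarrow> \<lfloor>of_int Q * z\<rfloor> = a n \<Longrightarrow> z \<in> B n"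
    by blast
  \<comment> \<open>Chosen so that Q^s = Q - 1/2, strictly between Q - 1 and Q.\<close>
  define s where "s = ln (of_int Q - 1/2) / ln (of_int Q :: real)"
  have s: "0 < s" "s < 1" using Q by (auto simp: s_def)
  have Qs: "of_int (Q - 1) < of_int Q powr s"
    using Q by (simp add: s_def powr_def)
  \<comment> \<open>K is the union over N of the sets of points that avoid the balls from time N on,
    so it is enough that each of them is null.\<close>
  define E where "E N = {x \<in> {0..<1}. \<forall>n\<ge>N. (T_map b ^^ n) x \<notin> B n}" for N
  have "hausdorff_measure s (E N) = 0" for N
  proof (rule hausdorff_measure_forbidden_digits_null[where N = "N + N0" and a = "\<lambda>k. a (m * k)"])
    fix k :: nat assume "k \<ge> N + N0"
    then have k: "m * k \<ge> N + N0"
      using m(2) mult_le_mono[of 1 m "N + N0" k] by simp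
    then show "a (m * k) \<in> {0..<Q}" using a by auto
    fix x assume x: "x \<in> E N"
    have "base_digit Q x k = \<lfloor>of_int Q * (T_map b ^^ (m * k)) x\<rfloor>"
      using x funpow_T_map[where x = x and b = b and n = "m * k"] unfolding Q_def base_digit_power E_def by auto
    \<comment> \<open>Digit \<open>a (m * k)\<close> at place k would put the orbit at time m k into
      a cell contained in \<open>B (m * k)\<close>.\<close>
    then show "base_digit Q x k \<noteq> a (m * k)"
      using aB[of "m * k" "(T_map b ^^ (m * k)) x"] x k unfolding E_def by auto
  qed (use Q s Qs in \<open>auto simp: E_def\<close>)
  then have null: "hausdorff_measure s (\<Union>N. E N) = 0"
    by (rule hausdorff_measure_UN_null)
  have "K_set b B \<subseteq> (\<Union>N. E N)"
  proof
    fix x assume x: "x \<in> K_set b B"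
    then obtain N where "\<And>n. (T_map b ^^ n) x \<in> B n \<Longrightarrow> n < N"
      unfolding K_set_def finite_nat_set_iff_bounded by auto
    then have "\<forall>n\<ge>N. (T_map b ^^ n) x \<notin> B n" using leD by blast
    then have "x \<in> E N" using x by (simp add: E_def K_set_def)
    then show "x \<in> (\<Union>N. E N)" by blast
  qed
  then have "hausdorff_measure s (K_set b B) = 0"
    using hausdorff_measure_mono[of "K_set b B" "\<Union>N. E N" s] null by simp
  then have "hausdorff_dim (K_set b B) \<le> ennreal s"
    unfolding hausdorff_dim_def using s by (intro INF_lower) auto
  also have "\<dots> < 1" using s by (simp add: ennreal_less_one_iff)
  finally show ?thesis .
qed

section \<open>Part (i): block length, excluded digits, and the conclusion\<close>

lemma hausdorff_dim_le_1:
  assumes "E \<subseteq> {0..<1::real}"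
  shows "hausdorff_dim E \<le> 1"
proof (rule ennreal_le_epsilon)
  fix e :: real assume e: "e > 0"
  \<comment> \<open>The measure at exponent 1 need not vanish, so the bound is approached through 1
    + e.\<close>
  have "hausdorff_measure (1 + e) E = 0"
    using hausdorff_measure_mono[OF assms, of "1 + e"] hausdorff_measure_unit_interval_null[of "1 + e"] e
    by simp
  then have "hausdorff_dim E \<le> ennreal (1 + e)"
    unfolding hausdorff_dim_def using e by (intro INF_lower) auto
  then show "hausdorff_dim E \<le> 1 + ennreal e" using e by (simp add: ennreal_plus)
qed

text \<open>After division by b^l every term on the left tends to 0. With Q = b^l the slack 2 l + 3
  ensures that q = Q - 1 - 2 l is at least 2 and at least Q^s.\<close>

lemma exists_block_length:
  fixes b s :: real
  assumes "b \<ge> 2" "s < 1"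
  shows "\<exists>l\<ge>1::nat. (b ^ l) powr s + 2 * real l + 3 \<le> b ^ l"
proof -
  have "b powr s < b powr 1" using assms by (intro powr_less_mono) auto
  then have "(\<lambda>l. (b powr s / b) ^ l) \<longlonglongrightarrow> 0"
    using assms by (intro LIMSEQ_realpow_zero) auto
  moreover have "(\<lambda>l. of_nat l * (1 / b) ^ l) \<longlonglongrightarrow> 0"
    using assms by (intro powser_times_n_limit_0) auto
  moreover have "(\<lambda>l. (1 / b) ^ l) \<longlonglongrightarrow> 0"
    using assms by (intro LIMSEQ_realpow_zero) auto
  ultimately have "(\<lambda>l. (b powr s / b) ^ l + 2 * (real l * (1 / b) ^ l) + 3 * (1 / b) ^ l) \<longlonglongrightarrow> 0 + 2 * 0 + 3 * 0"
    by (intro tendsto_add tendsto_mult tendsto_const)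
  then have "\<forall>\<^sub>F l in sequentially. (b powr s / b) ^ l + 2 * (real l * (1 / b) ^ l) + 3 * (1 / b) ^ l < 1"
    by (intro order_tendstoD(2)[where y = 0]) auto
  then have "\<forall>\<^sub>F l in sequentially. l \<ge> 1 \<and> (b powr s / b) ^ l + 2 * (real l * (1 / b) ^ l) + 3 * (1 / b) ^ l < 1"
    using eventually_ge_at_top[of 1] by eventually_elim auto
  then obtain l where l: "l \<ge> 1" "(b powr s / b) ^ l + 2 * (real l * (1 / b) ^ l) + 3 * (1 / b) ^ l < 1"
    using eventually_happens'[OF sequentially_bot] by blast
  have "(b ^ l) powr s = (b powr s) ^ l"
    using assms by (simp add: powr_realpow[symmetric] powr_powr mult.commute)
  moreover have "((b powr s) ^ l + 2 * real l + 3) / b ^ l < 1"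
    using l(2) by (simp add: power_divide add_divide_distrib power_one_over)
  ultimately show ?thesis using l(1) assms by (intro exI[of _ l]) (auto simp: field_simps)
qed

lemma hausdorff_measure_K_set_nonzero:
  fixes b :: int and B :: "nat \<Rightarrow> real set"
  assumes b: "b \<ge> 2" and bdd: "\<And>n. bounded (B n)"
    and lim: "(\<lambda>n. diameter (B n)) \<longlonglongrightarrow> 0" and s: "0 \<le> s" "s < 1"
  shows "hausdorff_measure s (K_set b B) \<noteq> 0"
proof -
  obtain l :: nat where l: "l \<ge> 1" and bl: "(of_int b ^ l) powr s + 2 * real l + 3 \<le> of_int b ^ l"
    using exists_block_length[of "of_int b" s] b s by auto
  define Q where "Q = b ^ l"
  have Ql: "of_int Q powr s + 2 * real l + 3 \<le> of_int Q" using bl by (simp add: Q_def)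
  moreover have "0 \<le> real_of_int Q powr s" by simp
  ultimately have "real_of_int (2 * int l + 3) \<le> of_int Q" by (simp del: powr_ge_zero)
  then have Q: "2 * int l + 3 \<le> Q" by (simp only: of_int_le_iff)
  define q where "q = nat (Q - 1 - 2 * int l)"
  have q: "q \<ge> 2" "real q = of_int Q - 1 - 2 * real l" using Q by (auto simp: q_def)
  \<comment> \<open>One factor b^l pays for Q and the other for b^i with i < l, so that Q b^i maps
    the ball into a set of spread below 1.\<close>
  have "\<forall>\<^sub>F n in sequentially. diameter (B n) < 1 / of_int b ^ (2 * l)"
    using lim by (rule order_tendstoD) (use b in auto)
  then obtain N0 where N0: "\<And>n. n \<ge> N0 \<Longrightarrow> diameter (B n) < 1 / of_int b ^ (2 * l)"
    unfolding eventually_sequentially by blast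
  \<comment> \<open>If the orbit is at z in \<open>B n\<close> at time n, its leading base-Q digit
    at time n + i is the floor of Q b^i z modulo Q; \<open>F n i\<close> collects these
    values.\<close>
  define F where "F n i = (\<lambda>z. \<lfloor>of_int Q * (of_int b ^ i * z)\<rfloor> mod Q) ` B n" for n i
  have F: "finite (F n i) \<and> card (F n i) \<le> 2" if n: "n \<ge> N0" and i: "i < l" for n i
  proof -
    have c: "of_int Q * of_int b ^ i \<le> (of_int b ^ (2 * l) :: real)"
      unfolding Q_def mult_2 power_add using b i by (auto intro!: mult_left_mono power_increasing)
    have "of_int Q * of_int b ^ i * \<bar>x - y\<bar> < 1" if "x \<in> B n" "y \<in> B n" for x y
    proof -
      have "of_int Q * of_int b ^ i * \<bar>x - y\<bar> \<le> of_int b ^ (2 * l) * \<bar>x - y\<bar>"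
        using c by (intro mult_right_mono) auto
      also have "\<bar>x - y\<bar> < 1 / of_int b ^ (2 * l)"
        using diameter_bounded_bound[OF bdd that] N0[OF n] by (simp add: dist_real_def)
      then have "of_int b ^ (2 * l) * \<bar>x - y\<bar> < 1"
        using b by (simp add: field_simps)
      finally show ?thesis .
    qed
    then obtain p where p: "(\<lambda>z. \<lfloor>of_int Q * of_int b ^ i * z\<rfloor>) ` B n \<subseteq> {p, p + 1}"
      using floor_image_subset_pair[of "B n" "of_int Q * of_int b ^ i"] Q b by auto
    have "F n i \<subseteq> {p mod Q, (p + 1) mod Q}"
    proof
      fix d assume "d \<in> F n i"
      then obtain z where z: "z \<in> B n" "d = \<lfloor>of_int Q * of_int b ^ i * z\<rfloor> mod Q"
        unfolding F_def by (auto simp: mult.assoc)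
      then have "\<lfloor>of_int Q * of_int b ^ i * z\<rfloor> \<in> {p, p + 1}" using p by blast
      then show "d \<in> {p mod Q, (p + 1) mod Q}" unfolding z(2) by auto
    qed
    moreover have "card {p mod Q, (p + 1) mod Q} \<le> 2"
      by (simp add: card_insert_if)
    ultimately show ?thesis
      using card_mono[of "{p mod Q, (p + 1) mod Q}" "F n i"] finite_subset[of "F n i"] by fastforce
  qed
  \<comment> \<open>The offsets i stand for the times j l - i charged to digit j. The additive
    condition keeps such times at least \<open>N0\<close> and the natural subtraction exact.\<close>
  define I where "I j = {i. i < l \<and> N0 + i \<le> j * l}" for j
  define A where "A j = {0..Q - 2} - (\<Union>i\<in>I j. F (j * l - i) i)" for j
  show ?thesis
  proof (rule hausdorff_measure_restricted_digits_nonzero[where A = A and Q = Q and q = q])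
    show "of_int Q powr s \<le> real q" using Ql q by simp
    show "A j \<subseteq> {0..Q - 2}" for j by (auto simp: A_def)
    show "q \<le> card (A j)" for j
    proof -
      have fI: "finite (I j)" and cI: "card (I j) \<le> l"
        using card_mono[of "{..<l}" "I j"] by (auto simp: I_def)
      have FI: "finite (F (j * l - i) i) \<and> card (F (j * l - i) i) \<le> 2" if "i \<in> I j" for i
        using that by (intro F) (auto simp: I_def)
      have "card (\<Union>i\<in>I j. F (j * l - i) i) \<le> (\<Sum>i\<in>I j. card (F (j * l - i) i))"
        by (rule card_UN_le[OF fI])
      also have "\<dots> \<le> (\<Sum>i\<in>I j. 2)" using FI by (intro sum_mono) auto
      also have "\<dots> \<le> 2 * l" using cI by simp
      finally have "card (\<Union>i\<in>I j. F (j * l - i) i) \<le> 2 * l" .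
      moreover have "card {0..Q - 2} - card (\<Union>i\<in>I j. F (j * l - i) i) \<le> card (A j)"
        unfolding A_def using fI FI by (intro diff_card_le_card_Diff) auto
      ultimately show ?thesis using Q by (simp add: q_def)
    qed
    show "x \<in> K_set b B" if x: "x \<in> {0..<1}" and dig: "\<And>j. base_digit Q x j \<in> A j" for x
    proof -
      have "n < N0" if Bn: "(T_map b ^^ n) x \<in> B n" for n
      proof (rule ccontr)
        assume "\<not> n < N0"
        \<comment> \<open>This is n / l rounded up, so the offset \<open>i\<close> satisfies 0 <= i
          < l.\<close>
        define j where "j = (n + (l - 1)) div l"
        define i where "i = j * l - n"
        have "j * l = n + (l - 1) - (n + (l - 1)) mod l" unfolding j_def by (simp add: minus_mod_eq_div_mult)
        moreover have "(n + (l - 1)) mod l < l" using l by simp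
        ultimately have jl: "n \<le> j * l" "j * l < n + l" using l by linarith+
        then have i: "i \<in> I j" "j * l - i = n" "j * l = i + n"
          using \<open>\<not> n < N0\<close> by (auto simp: i_def I_def)
        define z where "z = frac (of_int b ^ n * x)"
        have z: "z \<in> B n" using Bn funpow_T_map[OF x] by (simp add: z_def)
        have "of_int Q ^ j * x = of_int b ^ i * (of_int b ^ n * x)"
          unfolding Q_def using i(3) by (simp add: power_mult[symmetric] power_add mult.commute)
        also have "\<dots> = of_int b ^ i * z + of_int (b ^ i * \<lfloor>of_int b ^ n * x\<rfloor>)"
          by (simp add: z_def frac_def algebra_simps)
        finally have "frac (of_int Q ^ j * x) = frac (of_int b ^ i * z)"
          by (simp only: frac_add_of_int_right)
        then have "base_digit Q x j = base_digit Q (of_int b ^ i * z) 0"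
          unfolding base_digit_def by simp
        \<comment> \<open>A digit equals its own residue modulo Q, and modulo Q the term Q times the
          floor in \<open>base_digit_eq\<close> disappears, leaving the form used in
          \<open>F\<close>.\<close>
        also have "\<dots> = base_digit Q (of_int b ^ i * z) 0 mod Q"
          using base_digit_range[of Q "of_int b ^ i * z" 0] Q by simp
        also have "\<dots> = \<lfloor>of_int Q * (of_int b ^ i * z)\<rfloor> mod Q"
          unfolding base_digit_eq by (simp add: mod_diff_right_eq[symmetric])
        finally have "base_digit Q x j \<in> F (j * l - i) i"
          unfolding F_def i(2) using z by (rule image_eqI)
        then show False using dig[of j] i(1) by (auto simp: A_def)
      qed
      then have "{n. (T_map b ^^ n) x \<in> B n} \<subseteq> {..<N0}" by blast
      then have "finite {n. (T_map b ^^ n) x \<in> B n}" by (rule finite_subset) simp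
      then show ?thesis using x by (simp add: K_set_def)
    qed
  qed (use Q q s in auto)
qed

theorem theorem1p9:
  fixes b :: int and B :: "nat \<Rightarrow> real set"
  assumes "b \<ge> 3"
    and "\<And>n. open_ball_01 (B n)"
  shows "((\<lambda>n. diameter (B n)) \<longlonglongrightarrow> 0 \<longrightarrow> hausdorff_dim (K_set b B) = 1) \<and>
    (hausdorff_dim (K_set b B) = 1 \<longrightarrow> liminf (\<lambda>n. ereal (diameter (B n))) = 0)"
proof (intro conjI impI)
  have bdd: "bounded (B n)" for n
    using assms(2)[of n] unfolding open_ball_01_def by (auto intro: bounded_subset[OF bounded_ball])
  {
    assume lim: "(\<lambda>n. diameter (B n)) \<longlonglongrightarrow> 0"
    have "1 \<le> hausdorff_dim (K_set b B)"
      unfolding hausdorff_dim_def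
    proof (rule INF_greatest)
      fix s assume "s \<in> {s. 0 \<le> s \<and> hausdorff_measure s (K_set b B) = 0}"
      then have "1 \<le> s"
        using hausdorff_measure_K_set_nonzero[OF _ bdd lim, of b s] assms(1) by force
      then show "1 \<le> ennreal s" by simp
    qed
    moreover have "hausdorff_dim (K_set b B) \<le> 1"
      by (rule hausdorff_dim_le_1) (auto simp: K_set_def)
    ultimately show "hausdorff_dim (K_set b B) = 1" by simp
  next
    assume dim: "hausdorff_dim (K_set b B) = 1"
    show "liminf (\<lambda>n. ereal (diameter (B n))) = 0"
    proof (rule ccontr)
      assume "liminf (\<lambda>n. ereal (diameter (B n))) \<noteq> 0"
      moreover have "0 \<le> liminf (\<lambda>n. ereal (diameter (B n)))"
        using diameter_ge_0[OF bdd] by (intro Liminf_bounded) auto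
      ultimately have "0 < liminf (\<lambda>n. ereal (diameter (B n)))" by simp
      \<comment> \<open>A real number strictly below the liminf is eventually a strict lower bound
        for the diameters, even if the liminf were infinite.\<close>
      then obtain \<epsilon> :: real where \<epsilon>: "0 < ereal \<epsilon>" "ereal \<epsilon> < liminf (\<lambda>n. ereal (diameter (B n)))"
        using ereal_dense2 by blast
      have "\<forall>\<^sub>F n in sequentially. \<epsilon> < diameter (B n)"
        using less_LiminfD[OF \<epsilon>(2)] by simp
      then have "hausdorff_dim (K_set b B) < 1"
        using assms \<epsilon>(1) by (intro hausdorff_dim_K_set_less_1) auto
      then show False using dim by simp
    qed
  }
qed

end
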